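(* Let $m$ be a positive integer. Assume that there exist a positive integer $d$, $\alpha=(\alpha_1,\dots,\alpha_d)\in\mathbb{R}^d$ and $d$ real-valued functions $f_1,\dots,f_d$ on $\{1,\dots,m\}$ such that $$\mathcal{M}=\left\{s\in[0,1]^m:\sum_{i=1}^m s_i f_j(i)=\alpha_j,\ j\in\{1,\dots,d\}\right\}.$$ Moreover, suppose that $\mathcal{M}\cap(0,1)^m$ is nonempty and that $\mathcal{M}$ is not reduced to a singleton. Then there exist a positive integer $k\le m$, a bounded subset $\Theta$ of $\mathbb{R}^k$ with $\mathring\Theta\neq\emptyset$, and a function $\mathcal{S}:\bar\Theta\to[0,1]^m$ such that: (i) $\mathcal{S}$ is continuous and injective on $\bar\Theta$ and twice continuously differentiable on $\mathring\Theta$, $\mathcal{M}=\mathcal{S}(\bar\Theta)$ and $\mathcal{S}(\mathring\Theta)\subset(0,1)^m$; (ii) $\mathcal{S}(\mathring\Theta)=\mathcal{M}\cap(0,1)^m$; (iii) $\bar\Theta$ is convex and $\mathcal{S}$ is affine, that is, there exist an $m\times k$ matrix $A$ and $\gamma\in\mathbb{R}^m$ such that $\mathcal{S}(\theta)=A\theta+\gamma$ for all $\theta\in\bar\Theta$.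
   Context: $\bar\Theta$ and $\mathring\Theta$ denote the closure and interior of $\Theta$ in $\mathbb{R}^k$. *)

theory Defs
  imports "HOL-Analysis.Analysis"
begin

text \<open>
  The number \<open>k\<close> is existentially quantified, so \<open>\<real>\<^sup>n\<close> is represented as
  \<^term>\<open>Euclidean_space n\<close>: sequences \<open>x :: nat \<Rightarrow> real\<close> with \<open>x i = 0\<close> for \<open>i \<ge> n\<close>. Indices
  \<open>1, \<dots>, n\<close> become \<open>0, \<dots>, n - 1\<close>. Closures and interiors are taken in this topology.
\<close>

definition unit_cube :: "nat \<Rightarrow> (nat \<Rightarrow> real) set" where
  "unit_cube n = {x \<in> topspace (Euclidean_space n). \<forall>i<n. 0 \<le> x i \<and> x i \<le> 1}"

definition open_unit_cube :: "nat \<Rightarrow> (nat \<Rightarrow> real) set" where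
  "open_unit_cube n = {x \<in> topspace (Euclidean_space n). \<forall>i<n. 0 < x i \<and> x i < 1}"

text \<open>
  The library's \<open>bounded\<close> on \<open>nat \<Rightarrow> real\<close> refers to a product metric under which every set
  is bounded, and \<open>convex\<close> needs a type of class \<open>real_vector\<close>. Hence the following two
  definitions; the first one uses the Euclidean norm.
\<close>

definition bounded_Euclidean :: "nat \<Rightarrow> (nat \<Rightarrow> real) set \<Rightarrow> bool" where
  "bounded_Euclidean n X \<longleftrightarrow>
     X \<subseteq> topspace (Euclidean_space n) \<and> (\<exists>B. \<forall>x\<in>X. L2_set x {..<n} \<le> B)"

definition convex_fun_set :: "(nat \<Rightarrow> real) set \<Rightarrow> bool" where
  "convex_fun_set X \<longleftrightarrow>
     (\<forall>x\<in>X. \<forall>y\<in>X. \<forall>u v. 0 \<le> u \<longrightarrow> 0 \<le> v \<longrightarrow> u + v = 1 \<longrightarrow> (\<lambda>i. u * x i + v * y i) \<in> X)"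

text \<open>
  For \<open>U\<close> open in \<open>\<real>\<^sup>n\<close>: all partial derivatives of \<open>f\<close> of order at most \<open>r\<close> exist and are
  continuous on \<open>U\<close>. The function \<open>g i\<close> is the partial derivative in the \<open>i\<close>-th coordinate.
\<close>

primrec cont_diff_on :: "nat \<Rightarrow> nat \<Rightarrow> (nat \<Rightarrow> real) set \<Rightarrow> ((nat \<Rightarrow> real) \<Rightarrow> real) \<Rightarrow> bool" where
  "cont_diff_on 0 n U f \<longleftrightarrow>
     continuous_map (subtopology (Euclidean_space n) U) euclideanreal f"
| "cont_diff_on (Suc r) n U f \<longleftrightarrow>
     continuous_map (subtopology (Euclidean_space n) U) euclideanreal f \<and>
     (\<exists>g. \<forall>i<n.
        (\<forall>x\<in>U. ((\<lambda>t. f (x(i := t))) has_real_derivative g i x) (at (x i))) \<and>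
        cont_diff_on r n U (g i))"

end

theory Submission
  imports Defs
begin

text \<open>
  Gaussian elimination expresses all coordinates of a solution of the linear system as affine
  functions of some free coordinates. Hence \<open>M\<close> is a graph over its projection \<open>\<Theta>\<close> to the free
  coordinates, and \<open>\<Theta>\<close> lies in a cube because its points are coordinates of points of \<open>M\<close>. At an
  interior point of \<open>\<Theta>\<close> no affine constraint \<open>0 \<le> S \<theta> i \<le> 1\<close> can be tight: a nonconstant affine
  function takes values on both sides nearby, and a constant one has the value of a point of \<open>M\<close>
  in the open cube.
\<close>

text \<open>Equations are eliminated one at a time by induction on \<open>d\<close>, and
  \<open>J\<close> holds the coordinates still free. The rows of \<open>A\<close> indexed by
  \<open>J\<close> form an identity matrix, so the equations for \<open>i \<in> J\<close> are
  vacuous and the values on \<open>J\<close> can be chosen arbitrarily.\<close>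

lemma homogeneous_system_free_coordinates:
  fixes f :: "nat \<Rightarrow> nat \<Rightarrow> real" and m d :: nat
  shows "\<exists>J A. J \<subseteq> {..<m} \<and> (\<forall>j\<in>J. \<forall>l\<in>J. A j l = (if j = l then 1 else 0)) \<and>
    (\<forall>v. (\<forall>j<d. (\<Sum>i<m. v i * f j i) = 0) \<longleftrightarrow> (\<forall>i<m. v i = (\<Sum>j\<in>J. A i j * v j)))"
proof (induction d)
  case 0
  show ?case
    by (intro exI[of _ "{..<m}"] exI[of _ "\<lambda>i j. if i = j then 1 else 0"]) (auto simp: if_distrib[of "\<lambda>x. x * _"] cong: if_cong)
next
  case (Suc d)
  then obtain J A where J: "J \<subseteq> {..<m}"
    and delta: "\<And>j l. j \<in> J \<Longrightarrow> l \<in> J \<Longrightarrow> A j l = (if j = l then 1 else 0)"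
    and sol: "\<And>v. (\<forall>j<d. (\<Sum>i<m. v i * f j i) = 0) \<longleftrightarrow> (\<forall>i<m. v i = (\<Sum>j\<in>J. A i j * v j))"
    by blast
  have fin: "finite J"
    using J finite_subset by blast
  \<comment> \<open>Substituting the solution of the first \<open>d\<close> equations into the next
    one leaves an equation in the free coordinates alone; these are its coefficients.\<close>
  define c where "c j = (\<Sum>i<m. A i j * f d i)" for j
  have eq: "(\<Sum>i<m. v i * f d i) = (\<Sum>j\<in>J. c j * v j)"
    if "\<forall>i<m. v i = (\<Sum>j\<in>J. A i j * v j)" for v
  proof -
    have "(\<Sum>i<m. v i * f d i) = (\<Sum>i<m. \<Sum>j\<in>J. A i j * v j * f d i)"
      by (intro sum.cong refl) (metis that lessThan_iff sum_distrib_right)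
    also have "\<dots> = (\<Sum>j\<in>J. \<Sum>i<m. A i j * v j * f d i)"
      by (rule sum.swap)
    finally show ?thesis
      by (simp add: c_def sum_distrib_left mult_ac)
  qed
  have sol_Suc: "(\<forall>j<Suc d. (\<Sum>i<m. v i * f j i) = 0) \<longleftrightarrow>
      (\<forall>i<m. v i = (\<Sum>j\<in>J. A i j * v j)) \<and> (\<Sum>j\<in>J. c j * v j) = 0" for v
    using sol[of v] eq[of v] by (auto simp: less_Suc_eq)
  show ?case
  proof (cases "\<forall>j\<in>J. c j = 0")
    \<comment> \<open>The next equation already follows from the earlier ones, so \<open>J\<close>
      and \<open>A\<close> stay as they are.\<close>
    case True
    then have "(\<Sum>j\<in>J. c j * v j) = 0" for v :: "nat \<Rightarrow> real"
      by simp
    then show ?thesis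
      using J delta sol_Suc by (intro exI[of _ J] exI[of _ A]) auto
  next
    case False
    then obtain q where q: "q \<in> J" "c q \<noteq> 0"
      by blast
    \<comment> \<open>The new equation is solved for \<open>v q\<close>, and the result is
      substituted into the expansions given by \<open>A\<close>. Coordinate \<open>q\<close> stops
      being free.\<close>
    define B where "B i j = A i j - A i q * c j / c q" for i j
    have split: "(\<Sum>j\<in>J. g j) = g q + (\<Sum>j\<in>J - {q}. g j)" for g :: "nat \<Rightarrow> real"
      using fin q(1) by (rule sum.remove)
    have B_sum: "(\<Sum>j\<in>J - {q}. B i j * v j) =
        (\<Sum>j\<in>J - {q}. A i j * v j) - A i q / c q * (\<Sum>j\<in>J - {q}. c j * v j)" for i v
      by (simp add: B_def sum_subtractf sum_distrib_left algebra_simps)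
    have sol_B: "(\<forall>i<m. v i = (\<Sum>j\<in>J. A i j * v j)) \<and> (\<Sum>j\<in>J. c j * v j) = 0 \<longleftrightarrow>
        (\<forall>i<m. v i = (\<Sum>j\<in>J - {q}. B i j * v j))" for v
    proof -
      have c0: "(\<Sum>j\<in>J. c j * v j) = 0 \<longleftrightarrow> v q = - (\<Sum>j\<in>J - {q}. c j * v j) / c q"
        using q(2) by (subst split) (auto simp: field_simps)
      \<comment> \<open>The solved equation is recovered from row \<open>q\<close> of
        \<open>B\<close>: on \<open>J - {q}\<close> row \<open>q\<close> of \<open>A\<close>
        vanishes and \<open>A q q = 1\<close>, so the entries are
        \<open>- c j / c q\<close>.\<close>
      have "v q = - (\<Sum>j\<in>J - {q}. c j * v j) / c q" if "\<forall>i<m. v i = (\<Sum>j\<in>J - {q}. B i j * v j)"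
      proof -
        have "(\<Sum>j\<in>J - {q}. A q j * v j) = 0"
          using q(1) delta by (intro sum.neutral) auto
        then show ?thesis
          using that J q(1) delta[of q q] B_sum[of q v] by auto
      qed
      moreover have "(\<Sum>j\<in>J. A i j * v j) = (\<Sum>j\<in>J - {q}. B i j * v j)"
        if "v q = - (\<Sum>j\<in>J - {q}. c j * v j) / c q" for i
        unfolding B_sum split[of "\<lambda>j. A i j * v j"] that by simp
      ultimately show ?thesis
        unfolding c0 by auto
    qed
    \<comment> \<open>For \<open>j \<in> J - {q}\<close> the correction term vanishes because
      \<open>A j q = 0\<close>, so these rows agree with those of \<open>A\<close>.\<close>
    have "B j l = (if j = l then 1 else 0)" if "j \<in> J - {q}" "l \<in> J - {q}" for j l
      using that delta q(1) by (auto simp: B_def)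
    then show ?thesis
      using J sol_Suc sol_B by (intro exI[of _ "J - {q}"] exI[of _ B]) auto
  qed
qed

section \<open>Affine forms: continuity, smoothness and bounds at interior points\<close>

definition affine_form :: "nat \<Rightarrow> (nat \<Rightarrow> real) \<Rightarrow> real \<Rightarrow> (nat \<Rightarrow> real) \<Rightarrow> real" where
  "affine_form k a b x = (\<Sum>l<k. a l * x l) + b"

lemma affine_form_upd:
  "l < k \<Longrightarrow> affine_form k a b (x(l := t)) = affine_form k a b x + a l * (t - x l)"
  by (simp add: affine_form_def sum.remove[of "{..<k}" l] algebra_simps)

lemma affine_form_convex_comb:
  "u + v = 1 \<Longrightarrow>
    affine_form k a b (\<lambda>i. u * x i + v * y i) = u * affine_form k a b x + v * affine_form k a b y"
proof -
  assume "u + v = 1"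
  then have "b = u * b + v * b"
    by (metis distrib_right mult_1)
  then show ?thesis
    by (simp add: affine_form_def sum.distrib sum_distrib_left algebra_simps)
qed

lemma continuous_map_Euclidean_space_component:
  "continuous_map (Euclidean_space k) euclideanreal (\<lambda>x. x l)"
  unfolding Euclidean_space_def
  by (intro continuous_map_from_subtopology continuous_map_product_projection) auto

lemma continuous_map_affine_form:
  "continuous_map (Euclidean_space k) euclideanreal (affine_form k a b)"
  unfolding affine_form_def
  by (intro continuous_map_add continuous_map_sum continuous_map_real_mult
      continuous_map_Euclidean_space_component) auto

lemma continuous_map_into_Euclidean_space:
  assumes "\<And>i. continuous_map X euclideanreal (\<lambda>x. f x i)"
    and "\<And>x i. x \<in> topspace X \<Longrightarrow> n \<le> i \<Longrightarrow> f x i = 0"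
  shows "continuous_map X (Euclidean_space n) f"
  using assms unfolding Euclidean_space_def
  by (auto simp: continuous_map_in_subtopology continuous_map_componentwise_UNIV)

lemma cont_diff_on_const: "cont_diff_on r n U (\<lambda>x. c)"
proof (induction r arbitrary: c)
  case (Suc r)
  show ?case
    using Suc[of 0] by (auto intro!: exI[of _ "\<lambda>i x. 0"])
qed simp

text \<open>The partial derivatives are the constants \<open>a i\<close>, so one unfolding reduces
  every positive order to \<open>cont_diff_on_const\<close>.\<close>

lemma cont_diff_on_affine_form: "cont_diff_on r n U (affine_form n a b)"
proof (cases r)
  case 0
  then show ?thesis
    by (simp add: continuous_map_from_subtopology continuous_map_affine_form)
next
  case (Suc r')
  have "((\<lambda>t. affine_form n a b (x(i := t))) has_real_derivative a i) (at (x i))" if "i < n" for i x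
    unfolding affine_form_upd[OF that] by (auto intro!: derivative_eq_intros)
  then show ?thesis
    using Suc cont_diff_on_const
    by (auto simp: continuous_map_from_subtopology continuous_map_affine_form intro!: exI[of _ "\<lambda>i x. a i"])
qed

text \<open>From an interior point one can move a little both ways along coordinate
  \<open>l\<close>. The form changes by \<open>a l * t\<close> one way and \<open>- a l * t\<close>
  the other, so a tight bound would fail on one side.\<close>

lemma affine_form_strict_bounds_at_interior:
  assumes x: "x \<in> Euclidean_space k interior_of T" and "l < k" "a l \<noteq> 0"
    and T: "\<And>y. y \<in> T \<Longrightarrow> 0 \<le> affine_form k a b y \<and> affine_form k a b y \<le> 1"
  shows "0 < affine_form k a b x \<and> affine_form k a b x < 1"
proof -
  obtain U where U: "openin (Euclidean_space k) U" "x \<in> U" "U \<subseteq> T"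
    using x unfolding interior_of_def by blast
  have top: "x \<in> topspace (Euclidean_space k)"
    using U openin_subset by blast
  let ?h = "\<lambda>t. x(l := x l + t)"
  \<comment> \<open>Pulling \<open>U\<close> back along this line gives an open set of shifts around
    0, hence an interval of admissible ones.\<close>
  have "continuous_map euclideanreal (Euclidean_space k) ?h"
    using top \<open>l < k\<close>
    by (intro continuous_map_into_Euclidean_space)
      (auto simp: topspace_Euclidean_space fun_upd_def intro!: continuous_intros)
  then have "open {t. ?h t \<in> U}"
    using U(1) by (auto simp: continuous_map_def)
  moreover have "0 \<in> {t. ?h t \<in> U}"
    using U(2) by simp
  ultimately obtain e where "e > 0" and ball: "ball 0 e \<subseteq> {t. ?h t \<in> U}"
    by (rule openE)
  then have e: "e > 0" "\<And>t. \<bar>t\<bar> < e \<Longrightarrow> ?h t \<in> U"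
    by (auto simp: subset_iff)
  \<comment> \<open>The sign makes \<open>a l * t\<close> positive; the half keeps both shifts
    strictly inside the interval.\<close>
  define t where "t = (if a l > 0 then e / 2 else - (e / 2))"
  have "a l * t > 0"
    using e(1) \<open>a l \<noteq> 0\<close> by (auto simp: t_def mult_less_0_iff zero_less_mult_iff)
  moreover have "\<bar>t\<bar> < e" "\<bar>- t\<bar> < e"
    using e(1) by (auto simp: t_def)
  then have "?h t \<in> T" "?h (- t) \<in> T"
    using e(2) U(3) by blast+
  then have "0 \<le> affine_form k a b x + a l * t \<and> affine_form k a b x + a l * t \<le> 1"
      and "0 \<le> affine_form k a b x - a l * t \<and> affine_form k a b x - a l * t \<le> 1"
    using T affine_form_upd[OF \<open>l < k\<close>, of a b x] by fastforce+
  ultimately show ?thesis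
    by linarith
qed

section \<open>The parametrization of \<open>M\<close> by its free coordinates\<close>

theorem proposition32:
  fixes m :: nat and M :: "(nat \<Rightarrow> real) set"
  assumes "0 < m"
    and "\<exists>d>0. \<exists>(\<alpha> :: nat \<Rightarrow> real) (f :: nat \<Rightarrow> nat \<Rightarrow> real).
           M = {s \<in> unit_cube m. \<forall>j<d. (\<Sum>i<m. s i * f j i) = \<alpha> j}"
    and "M \<inter> open_unit_cube m \<noteq> {}"
    and "\<not> is_singleton M"
  shows "\<exists>k \<Theta> (S :: (nat \<Rightarrow> real) \<Rightarrow> (nat \<Rightarrow> real)).
    0 < k \<and> k \<le> m \<and>
    bounded_Euclidean k \<Theta> \<and>
    Euclidean_space k interior_of \<Theta> \<noteq> {} \<and>
    S \<in> (Euclidean_space k closure_of \<Theta>) \<rightarrow> unit_cube m \<and>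
    \<comment> \<open>(i)\<close>
    continuous_map (subtopology (Euclidean_space k) (Euclidean_space k closure_of \<Theta>))
      (Euclidean_space m) S \<and>
    inj_on S (Euclidean_space k closure_of \<Theta>) \<and>
    (\<forall>i<m. cont_diff_on 2 k (Euclidean_space k interior_of \<Theta>) (\<lambda>\<theta>. S \<theta> i)) \<and>
    M = S ` (Euclidean_space k closure_of \<Theta>) \<and>
    S ` (Euclidean_space k interior_of \<Theta>) \<subseteq> open_unit_cube m \<and>
    \<comment> \<open>(ii)\<close>
    S ` (Euclidean_space k interior_of \<Theta>) = M \<inter> open_unit_cube m \<and>
    \<comment> \<open>(iii)\<close>
    convex_fun_set (Euclidean_space k closure_of \<Theta>) \<and>
    (\<exists>(A :: nat \<Rightarrow> nat \<Rightarrow> real) (\<gamma> :: nat \<Rightarrow> real).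
       \<forall>\<theta> \<in> Euclidean_space k closure_of \<Theta>. \<forall>i<m. S \<theta> i = (\<Sum>j<k. A i j * \<theta> j) + \<gamma> i)"
proof -
  obtain d :: nat and \<alpha> f where M: "M = {s \<in> unit_cube m. \<forall>j<d. (\<Sum>i<m. s i * f j i) = \<alpha> j}"
    using assms(2) by blast
  obtain x0 where x0: "x0 \<in> M" "x0 \<in> open_unit_cube m"
    using assms(3) by blast
  obtain J A where J: "J \<subseteq> {..<m}"
    and delta: "\<And>j l. j \<in> J \<Longrightarrow> l \<in> J \<Longrightarrow> A j l = (if j = l then 1 else 0)"
    and sol: "\<And>v. (\<forall>j<d. (\<Sum>i<m. v i * f j i) = 0) \<longleftrightarrow> (\<forall>i<m. v i = (\<Sum>j\<in>J. A i j * v j))"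
    using homogeneous_system_free_coordinates[of m d f] by blast
  have fin: "finite J"
    using J finite_subset by blast
  define k where "k = card J"
  have "k \<le> m"
    using card_mono[OF _ J] by (simp add: k_def)
  \<comment> \<open>The free coordinates are renumbered by \<open>0, \<dots>, k - 1\<close> to serve
    as coordinates of \<open>Euclidean_space k\<close>.\<close>
  obtain p where p: "bij_betw p {..<k} J"
    using ex_bij_betw_nat_finite[OF fin] by (auto simp: k_def atLeast0LessThan)
  \<comment> \<open>Differences \<open>s - x0\<close> of solutions solve the homogeneous system;
    \<open>\<gamma>\<close> collects the terms coming from \<open>x0\<close>.\<close>
  define \<gamma> where "\<gamma> i = x0 i - (\<Sum>j\<in>J. A i j * x0 j)" for i
  define L where "L i = affine_form k (\<lambda>l. A i (p l)) (\<gamma> i)" for i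
  have M_iff: "s \<in> M \<longleftrightarrow> s \<in> unit_cube m \<and> (\<forall>i<m. s i = L i (\<lambda>l. s (p l)))" for s
  proof -
    have "(\<forall>j<d. (\<Sum>i<m. s i * f j i) = \<alpha> j) \<longleftrightarrow> (\<forall>j<d. (\<Sum>i<m. (s i - x0 i) * f j i) = 0)"
      using x0(1) by (auto simp: M left_diff_distrib sum_subtractf)
    also have "\<dots> \<longleftrightarrow> (\<forall>i<m. s i - x0 i = (\<Sum>j\<in>J. A i j * (s j - x0 j)))"
      by (rule sol)
    also have "\<dots> \<longleftrightarrow> (\<forall>i<m. s i = (\<Sum>j\<in>J. A i j * s j) + \<gamma> i)"
      by (auto simp: \<gamma>_def right_diff_distrib sum_subtractf algebra_simps)
    also have "\<dots> \<longleftrightarrow> (\<forall>i<m. s i = L i (\<lambda>l. s (p l)))"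
      unfolding L_def affine_form_def
      by (simp add: sum.reindex_bij_betw[OF p, of "\<lambda>j. A _ j * s j"])
    finally show ?thesis
      by (auto simp: M)
  qed
  \<comment> \<open>On free coordinates the parametrization is the identity. Injectivity of
    \<open>S\<close> and boundedness of \<open>\<Theta>\<close> both rest on this.\<close>
  have L_p: "L (p l) \<theta> = \<theta> l" if "l < k" for l \<theta>
  proof -
    have pl: "p l \<in> J"
      using p that bij_betwE by blast
    have "A (p l) (p l') = (if l' = l then 1 else 0)" if "l' < k" for l'
      using p that \<open>l < k\<close> delta[OF pl, of "p l'"] by (auto simp: bij_betw_def inj_on_def)
    then have "(\<Sum>l'<k. A (p l) (p l') * \<theta> l') = \<theta> l"
      using that by (simp add: if_distrib[of "\<lambda>x. x * _"] cong: if_cong)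
    moreover have "(\<Sum>j\<in>J. A (p l) j * x0 j) = (\<Sum>j\<in>J. if j = p l then x0 j else 0)"
      using delta pl by (intro sum.cong) auto
    then have "\<gamma> (p l) = 0"
      using fin pl by (simp add: \<gamma>_def)
    ultimately show ?thesis
      by (simp add: L_def affine_form_def)
  qed
  have p_less: "p l < m" if "l < k" for l
    using that p J bij_betwE by blast
  \<comment> \<open>The projection of \<open>M\<close> is described by inequalities, from which
    closedness and convexity can be read off. \<open>S_in_M\<close> and \<open>M_proj\<close>
    confirm that it is the projection, with \<open>?proj\<close> inverse to
    \<open>S\<close>.\<close>
  define \<Theta> where "\<Theta> = {\<theta> \<in> topspace (Euclidean_space k). \<forall>i<m. 0 \<le> L i \<theta> \<and> L i \<theta> \<le> 1}"
  define S where "S \<theta> i = (if i < m then L i \<theta> else 0)" for \<theta> i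
  let ?proj = "\<lambda>s l. if l < k then s (p l) else 0"
  have proj: "L i (?proj s) = L i (\<lambda>l. s (p l))" for i s
    by (simp add: L_def affine_form_def)
  have S_in_M: "S \<theta> \<in> M" if "\<theta> \<in> \<Theta>" for \<theta>
  proof -
    have "L i (\<lambda>l. S \<theta> (p l)) = L i \<theta>" for i
      using L_p p_less by (simp add: L_def affine_form_def S_def)
    then show ?thesis
      using that by (auto simp: M_iff \<Theta>_def S_def unit_cube_def topspace_Euclidean_space)
  qed
  have M_proj: "?proj s \<in> \<Theta> \<and> S (?proj s) = s" if "s \<in> M" for s
    using that
    by (auto simp: M_iff proj \<Theta>_def S_def unit_cube_def topspace_Euclidean_space fun_eq_iff)
  have L_cont: "continuous_map (Euclidean_space k) euclideanreal (L i)" for i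
    unfolding L_def by (rule continuous_map_affine_form)
  have \<Theta>_eq: "\<Theta> = topspace (Euclidean_space k) \<inter>
      (\<Inter>i<m. {\<theta> \<in> topspace (Euclidean_space k). L i \<theta> \<in> {0..1}})"
    by (auto simp: \<Theta>_def)
  have "closedin (Euclidean_space k) (\<Inter>i<m. {\<theta> \<in> topspace (Euclidean_space k). L i \<theta> \<in> {0..1}})"
    using \<open>0 < m\<close> by (intro closedin_INT closedin_continuous_map_preimage[OF L_cont]) auto
  then have "closedin (Euclidean_space k) \<Theta>"
    unfolding \<Theta>_eq by (intro closedin_Int) auto
  then have closure: "Euclidean_space k closure_of \<Theta> = \<Theta>"
    by (rule closure_of_closedin)
  define I where "I = {\<theta> \<in> topspace (Euclidean_space k). \<forall>i<m. 0 < L i \<theta> \<and> L i \<theta> < 1}"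
  have x0_L: "L i (?proj x0) = x0 i" "0 < x0 i \<and> x0 i < 1" if "i < m" for i
    using x0 that by (auto simp: M_iff proj open_unit_cube_def)
  have interior: "Euclidean_space k interior_of \<Theta> = I"
  proof
    have I_eq: "I = topspace (Euclidean_space k) \<inter>
        (\<Inter>i<m. {\<theta> \<in> topspace (Euclidean_space k). L i \<theta> \<in> {0<..<1}})"
      by (auto simp: I_def)
    have "openin (Euclidean_space k) (\<Inter>i<m. {\<theta> \<in> topspace (Euclidean_space k). L i \<theta> \<in> {0<..<1}})"
      using \<open>0 < m\<close> by (intro openin_INT2 openin_continuous_map_preimage[OF L_cont]) auto
    then have "openin (Euclidean_space k) I"
      unfolding I_eq by (intro openin_Int) auto
    moreover have "I \<subseteq> \<Theta>"
      by (auto simp: I_def \<Theta>_def)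
    ultimately show "I \<subseteq> Euclidean_space k interior_of \<Theta>"
      by (simp add: interior_of_maximal)
  next
    show "Euclidean_space k interior_of \<Theta> \<subseteq> I"
    proof
      fix \<theta> assume \<theta>: "\<theta> \<in> Euclidean_space k interior_of \<Theta>"
      have "0 < L i \<theta> \<and> L i \<theta> < 1" if "i < m" for i
      proof (cases "\<exists>l<k. A i (p l) \<noteq> 0")
        case True
        then show ?thesis
          using affine_form_strict_bounds_at_interior[OF \<theta>, of _ "\<lambda>l. A i (p l)" "\<gamma> i"] that
          by (auto simp: L_def \<Theta>_def)
      next
        case False
        then have "L i \<theta> = L i (?proj x0)"
          by (simp add: L_def affine_form_def)
        then show ?thesis
          using x0_L[OF that] by simp
      qed
      then show "\<theta> \<in> I"
        using subsetD[OF interior_of_subset_topspace \<theta>] by (auto simp: I_def)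
    qed
  qed
  have "?proj x0 \<in> I"
    using x0_L by (auto simp: I_def topspace_Euclidean_space)
  have "0 < k"
  proof (rule ccontr)
    \<comment> \<open>With no free coordinates \<open>?proj\<close> sends all of \<open>M\<close> to
      the zero sequence, so \<open>M\<close> would be \<open>{x0}\<close>.\<close>
    assume "\<not> 0 < k"
    then have "s = x0" if "s \<in> M" for s
      using M_proj[OF that] M_proj[OF x0(1)] by simp
    then show False
      using assms(4) x0(1) by (auto simp: is_singleton_def)
  qed
  have bounded: "bounded_Euclidean k \<Theta>"
    unfolding bounded_Euclidean_def
  proof (intro conjI exI ballI)
    fix \<theta> assume \<theta>: "\<theta> \<in> \<Theta>"
    have "L2_set \<theta> {..<k} \<le> (\<Sum>l<k. \<bar>\<theta> l\<bar>)"
      by (rule L2_set_le_sum_abs)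
    \<comment> \<open>Each \<open>\<theta> l\<close> equals \<open>L (p l) \<theta>\<close>, which
      lies between 0 and 1.\<close>
    also have "\<dots> \<le> (\<Sum>l<k. 1)"
      using \<theta> L_p p_less by (intro sum_mono) (fastforce simp: \<Theta>_def abs_le_iff)
    finally show "L2_set \<theta> {..<k} \<le> (\<Sum>l<k. 1)" .
  qed (auto simp: \<Theta>_def)
  have S_cont: "continuous_map (subtopology (Euclidean_space k) \<Theta>) (Euclidean_space m) S"
  proof (intro continuous_map_from_subtopology continuous_map_into_Euclidean_space)
    show "continuous_map (Euclidean_space k) euclideanreal (\<lambda>\<theta>. S \<theta> i)" for i
      using L_cont by (cases "i < m") (auto simp: S_def)
  qed (auto simp: S_def)
  have S_inj: "inj_on S \<Theta>"
  proof (rule inj_onI)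
    fix \<theta> \<eta> assume *: "\<theta> \<in> \<Theta>" "\<eta> \<in> \<Theta>" "S \<theta> = S \<eta>"
    have "\<theta> l = \<eta> l" for l
    proof (cases "l < k")
      case True
      then show ?thesis
        using fun_cong[OF *(3), of "p l"] L_p p_less by (simp add: S_def)
    next
      case False
      then show ?thesis
        using * by (auto simp: \<Theta>_def topspace_Euclidean_space)
    qed
    then show "\<theta> = \<eta>" ..
  qed
  have S_diff: "cont_diff_on 2 k I (\<lambda>\<theta>. S \<theta> i)" if "i < m" for i
    using that cont_diff_on_affine_form by (simp add: S_def L_def)
  have S_image: "M = S ` \<Theta>"
    using S_in_M M_proj by (force intro: rev_image_eqI)
  have S_interior: "S ` I = M \<inter> open_unit_cube m"
  proof
    show "S ` I \<subseteq> M \<inter> open_unit_cube m"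
      using S_in_M by (auto simp: I_def \<Theta>_def open_unit_cube_def S_def topspace_Euclidean_space less_imp_le)
    show "M \<inter> open_unit_cube m \<subseteq> S ` I"
    proof
      fix s assume s: "s \<in> M \<inter> open_unit_cube m"
      then have "?proj s \<in> I"
        by (auto simp: I_def M_iff proj open_unit_cube_def topspace_Euclidean_space)
      then show "s \<in> S ` I"
        using M_proj[of s] s by (auto intro!: rev_image_eqI[of "?proj s"])
    qed
  qed
  have convex: "convex_fun_set \<Theta>"
    unfolding convex_fun_set_def
  proof (intro ballI allI impI)
    fix x y and u v :: real
    assume *: "x \<in> \<Theta>" "y \<in> \<Theta>" "0 \<le> u" "0 \<le> v" "u + v = 1"
    have "0 \<le> u * L i x + v * L i y \<and> u * L i x + v * L i y \<le> 1" if "i < m" for i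
      using * that by (auto simp: \<Theta>_def intro!: convex_bound_le)
    then show "(\<lambda>i. u * x i + v * y i) \<in> \<Theta>"
      using * by (auto simp: \<Theta>_def L_def affine_form_convex_comb topspace_Euclidean_space)
  qed
  have S_cube: "S \<in> \<Theta> \<rightarrow> unit_cube m"
    using S_in_M by (auto simp: M_iff)
  have S_affine: "\<forall>\<theta>\<in>\<Theta>. \<forall>i<m. S \<theta> i = (\<Sum>l<k. A i (p l) * \<theta> l) + \<gamma> i"
    by (simp add: S_def L_def affine_form_def)
  have "I \<noteq> {}"
    using \<open>?proj x0 \<in> I\<close> by blast
  show ?thesis
  proof (rule exI[of _ k], rule exI[of _ \<Theta>], rule exI[of _ S], unfold closure interior, intro conjI)
    show "S ` I \<subseteq> open_unit_cube m"
      using S_interior by blast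
    show "\<forall>i<m. cont_diff_on 2 k I (\<lambda>\<theta>. S \<theta> i)"
      using S_diff by blast
    show "\<exists>A \<gamma>. \<forall>\<theta>\<in>\<Theta>. \<forall>i<m. S \<theta> i = (\<Sum>j<k. A i j * \<theta> j) + \<gamma> i"
      by (rule exI[of _ "\<lambda>i l. A i (p l)"], rule exI[of _ \<gamma>], rule S_affine)
  qed (fact \<open>0 < k\<close> \<open>k \<le> m\<close> bounded \<open>I \<noteq> {}\<close> S_cube S_cont S_inj S_image S_interior convex)+
qed

end
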